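(* Let $k$ be a field of characteristic $0$ and let $(A,\circ,[\cdot,\cdot])$ be a transposed Poisson algebra over $k$. Then for all $x_1,x_2,x_3,x_4\in A$ the following two identities hold: $$[x_1,(x_2\circ x_3)\circ x_4]-[x_1,x_2\circ x_3]\circ x_4-[x_1,x_2\circ x_4]\circ x_3+([x_1,x_2]\circ x_3)\circ x_4=0$$ and $$[x_4\circ x_1,x_3\circ x_2]-[x_3\circ x_1,x_4\circ x_2]+[x_3,x_4\circ x_1]\circ x_2-[x_4,x_3\circ x_2]\circ x_1$$ $$\qquad-[x_4,x_3\circ x_1]\circ x_2+[x_3,x_4\circ x_2]\circ x_1+2([x_4,x_3]\circ x_1)\circ x_2=0.$$
   Context: All algebras are over a field of characteristic $0$. A transposed Poisson algebra is a vector space with a commutative associative bilinear product $\circ$ and a Lie bracket $[\cdot,\cdot]$ satisfying for all $x_1,x_2,x_3$ $$2[x_1,x_2]\circ x_3=[x_1\circ x_3,x_2]+[x_1,x_2\circ x_3].$$ *)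

theory Defs
  imports Complex_Main
begin

definition bilinear_map ::
    "('k::field \<Rightarrow> 'a::ab_group_add \<Rightarrow> 'a) \<Rightarrow> ('a \<Rightarrow> 'a \<Rightarrow> 'a) \<Rightarrow> bool"
  where "bilinear_map scale b \<longleftrightarrow>
    (\<forall>x. Vector_Spaces.linear scale scale (\<lambda>y. b x y)) \<and>
    (\<forall>y. Vector_Spaces.linear scale scale (\<lambda>x. b x y))"

definition lie_bracket ::
    "('k::field \<Rightarrow> 'a::ab_group_add \<Rightarrow> 'a) \<Rightarrow> ('a \<Rightarrow> 'a \<Rightarrow> 'a) \<Rightarrow> bool"
  where "lie_bracket scale b \<longleftrightarrow>
    bilinear_map scale b \<and>
    (\<forall>x. b x x = 0) \<and>
    (\<forall>x y z. b x (b y z) + b y (b z x) + b z (b x y) = 0)"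

text \<open>The underlying vector space is the whole type \<open>'a\<close>, with scalar multiplication
  \<open>scale\<close>; the field \<open>'k\<close> has characteristic 0 by its type class. Associativity and
  commutativity of the product come from the library locale \<open>abel_semigroup\<close>.\<close>

locale transposed_poisson_algebra =
  vector_space scale + abel_semigroup circ
  for scale :: "'k::field_char_0 \<Rightarrow> 'a::ab_group_add \<Rightarrow> 'a"
    and circ :: "'a \<Rightarrow> 'a \<Rightarrow> 'a"  (infixl \<open>\<odot>\<close> 70)
    and brk :: "'a \<Rightarrow> 'a \<Rightarrow> 'a"  (\<open>\<lbrace>_, _\<rbrace>\<close>) +
  assumes circ_bilinear: "bilinear_map scale circ"
    and brk_lie: "lie_bracket scale brk"
    and transposed_leibniz:
      "\<And>x1 x2 x3. scale 2 (\<lbrace>x1, x2\<rbrace> \<odot> x3) = \<lbrace>x1 \<odot> x3, x2\<rbrace> + \<lbrace>x1, x2 \<odot> x3\<rbrace>"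

end

theory Submission
  imports Defs
begin

text \<open>The transposed Leibniz rule rewrites twice any product with a bracket as a sum of plain
  brackets. Multiplying \<open>\<lbrace>x, y\<rbrace>\<close> by \<open>a \<odot> b\<close> can be expanded in two ways: applying the rule once
  to the element \<open>a \<odot> b\<close> gives
  \<open>2 \<lbrace>x, y\<rbrace> \<odot> (a \<odot> b) = \<lbrace>x \<odot> a \<odot> b, y\<rbrace> + \<lbrace>x, y \<odot> a \<odot> b\<rbrace>\<close>, while applying it first with \<open>a\<close> and
  then with \<open>b\<close> writes \<open>4 \<lbrace>x, y\<rbrace> \<odot> (a \<odot> b)\<close> as the same two brackets plus
  \<open>\<lbrace>x \<odot> a, y \<odot> b\<rbrace> + \<lbrace>x \<odot> b, y \<odot> a\<rbrace>\<close>. Comparison shows that the split terms and the unsplit terms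
  have equal sums (\<open>brk_split_eq_unsplit\<close>).

  Twice the left-hand side of either identity expands, by the transposed Leibniz rule, into
  brackets of products. For the first identity what remains is an instance of
  \<open>brk_split_eq_unsplit\<close>. For the second, once the brackets are oriented alike by
  antisymmetry, everything cancels if \<open>(\<lbrace>y, x\<rbrace> \<odot> a) \<odot> b\<close> is expanded by the rule applied once
  to \<open>a \<odot> b\<close>. In characteristic 0 the factor 2 can be removed.

  The first identity says that \<open>\<lbrace>x, _\<rbrace>\<close> is a differential operator of order at most one on the
  commutative algebra: its double commutator with multiplication operators vanishes.\<close>

context transposed_poisson_algebra
begin

lemma circ_add_left: "(x + y) \<odot> z = x \<odot> z + y \<odot> z"
proof -
  interpret Vector_Spaces.linear scale scale "\<lambda>x. x \<odot> z"
    using circ_bilinear by (simp add: bilinear_map_def)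
  show ?thesis by (rule add)
qed

lemma circ_scale_left: "scale c x \<odot> z = scale c (x \<odot> z)"
proof -
  interpret Vector_Spaces.linear scale scale "\<lambda>x. x \<odot> z"
    using circ_bilinear by (simp add: bilinear_map_def)
  show ?thesis by (rule scale)
qed

lemma brk_antisym: "\<lbrace>x, y\<rbrace> = - \<lbrace>y, x\<rbrace>"
proof -
  have left: "\<lbrace>u + v, w\<rbrace> = \<lbrace>u, w\<rbrace> + \<lbrace>v, w\<rbrace>" for u v w
  proof -
    interpret Vector_Spaces.linear scale scale "\<lambda>u. \<lbrace>u, w\<rbrace>"
      using brk_lie by (simp add: lie_bracket_def bilinear_map_def)
    show ?thesis by (rule add)
  qed
  have right: "\<lbrace>w, u + v\<rbrace> = \<lbrace>w, u\<rbrace> + \<lbrace>w, v\<rbrace>" for u v w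
  proof -
    interpret Vector_Spaces.linear scale scale "\<lambda>u. \<lbrace>w, u\<rbrace>"
      using brk_lie by (simp add: lie_bracket_def bilinear_map_def)
    show ?thesis by (rule add)
  qed
  have self: "\<lbrace>u, u\<rbrace> = 0" for u
    using brk_lie by (simp add: lie_bracket_def)
  have "\<lbrace>x, y\<rbrace> + \<lbrace>y, x\<rbrace> = \<lbrace>x + y, x + y\<rbrace>"
    by (simp only: left right self[of x] self[of y] add_0_left add_0_right add.commute)
  then show ?thesis
    by (simp only: self eq_neg_iff_add_eq_0)
qed

lemma scale_two: "scale 2 x = x + x"
  using scale_left_distrib[of 1 1 x] by simp

lemma eq_0_if_scale_two_eq_0: "scale 2 x = 0 \<Longrightarrow> x = 0"
  by simp

text \<open>The element \<open>4 \<lbrace>x, y\<rbrace> \<odot> (a \<odot> b)\<close> is twice the right-hand side when the transposed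
  Leibniz rule is applied to \<open>a \<odot> b\<close>, and the sum of both sides when it is applied to \<open>a\<close>
  and then to \<open>b\<close>.\<close>

lemma brk_split_eq_unsplit:
  "\<lbrace>x \<odot> a, y \<odot> b\<rbrace> + \<lbrace>x \<odot> b, y \<odot> a\<rbrace> = \<lbrace>x \<odot> (a \<odot> b), y\<rbrace> + \<lbrace>x, y \<odot> (a \<odot> b)\<rbrace>"
proof -
  let ?unsplit = "\<lbrace>x \<odot> (a \<odot> b), y\<rbrace> + \<lbrace>x, y \<odot> (a \<odot> b)\<rbrace>"
  have once: "scale 2 (\<lbrace>x, y\<rbrace> \<odot> (a \<odot> b)) = ?unsplit"
    by (rule transposed_leibniz)
  have "?unsplit + ?unsplit = scale 2 (scale 2 (\<lbrace>x, y\<rbrace> \<odot> a \<odot> b))"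
    by (simp only: once assoc scale_two[of ?unsplit])
  also have "\<dots> = scale 2 ((\<lbrace>x \<odot> a, y\<rbrace> + \<lbrace>x, y \<odot> a\<rbrace>) \<odot> b)"
    by (simp only: circ_scale_left[symmetric] flip: transposed_leibniz)
  also have "\<dots> = (\<lbrace>x \<odot> a \<odot> b, y\<rbrace> + \<lbrace>x \<odot> a, y \<odot> b\<rbrace>) + (\<lbrace>x \<odot> b, y \<odot> a\<rbrace> + \<lbrace>x, y \<odot> a \<odot> b\<rbrace>)"
    by (simp only: circ_add_left scale_right_distrib transposed_leibniz)
  also have "\<dots> = ?unsplit + (\<lbrace>x \<odot> a, y \<odot> b\<rbrace> + \<lbrace>x \<odot> b, y \<odot> a\<rbrace>)"
    by (simp add: assoc algebra_simps)
  finally show ?thesis by simp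
qed

lemma brk_differential_operator:
  "\<lbrace>x, (y \<odot> a) \<odot> b\<rbrace> - \<lbrace>x, y \<odot> a\<rbrace> \<odot> b - \<lbrace>x, y \<odot> b\<rbrace> \<odot> a + (\<lbrace>x, y\<rbrace> \<odot> a) \<odot> b = 0"
  (is "?E = 0")
proof (rule eq_0_if_scale_two_eq_0)
  have "scale 2 ?E = (\<lbrace>x, y \<odot> a \<odot> b\<rbrace> + \<lbrace>x, y \<odot> a \<odot> b\<rbrace>)
      - (\<lbrace>x \<odot> b, y \<odot> a\<rbrace> + \<lbrace>x, y \<odot> a \<odot> b\<rbrace>) - (\<lbrace>x \<odot> a, y \<odot> b\<rbrace> + \<lbrace>x, y \<odot> b \<odot> a\<rbrace>)
      + (\<lbrace>x \<odot> (a \<odot> b), y\<rbrace> + \<lbrace>x, y \<odot> (a \<odot> b)\<rbrace>)"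
    by (simp only: scale_right_distrib scale_right_diff_distrib assoc[of "\<lbrace>x, y\<rbrace>"]
        transposed_leibniz scale_two[of "\<lbrace>x, y \<odot> a \<odot> b\<rbrace>"])
  also have "\<dots> = (\<lbrace>x \<odot> (a \<odot> b), y\<rbrace> + \<lbrace>x, y \<odot> (a \<odot> b)\<rbrace>) - (\<lbrace>x \<odot> a, y \<odot> b\<rbrace> + \<lbrace>x \<odot> b, y \<odot> a\<rbrace>)"
    by (simp add: assoc commute[of b a] algebra_simps)
  also have "\<dots> = 0"
    by (simp only: brk_split_eq_unsplit diff_self)
  finally show "scale 2 ?E = 0" .
qed

lemma brk_exchange:
  "\<lbrace>y \<odot> a, x \<odot> b\<rbrace> - \<lbrace>x \<odot> a, y \<odot> b\<rbrace>
     + \<lbrace>x, y \<odot> a\<rbrace> \<odot> b - \<lbrace>y, x \<odot> b\<rbrace> \<odot> a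
     - \<lbrace>y, x \<odot> a\<rbrace> \<odot> b + \<lbrace>x, y \<odot> b\<rbrace> \<odot> a
     + scale 2 ((\<lbrace>y, x\<rbrace> \<odot> a) \<odot> b) = 0"
  (is "?p - ?q + ?r - ?s - ?t + ?u + scale 2 ?v = 0")
proof (rule eq_0_if_scale_two_eq_0)
  let ?unsplit = "\<lbrace>x \<odot> (a \<odot> b), y\<rbrace> + \<lbrace>x, y \<odot> (a \<odot> b)\<rbrace>"
  have p: "?p = - \<lbrace>x \<odot> b, y \<odot> a\<rbrace>"
    by (rule brk_antisym)
  have r: "scale 2 ?r = \<lbrace>x \<odot> b, y \<odot> a\<rbrace> + \<lbrace>x, y \<odot> (a \<odot> b)\<rbrace>"
    by (simp only: transposed_leibniz assoc)
  have s: "scale 2 ?s = - \<lbrace>x \<odot> b, y \<odot> a\<rbrace> - \<lbrace>x \<odot> (a \<odot> b), y\<rbrace>"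
    by (simp only: transposed_leibniz)
      (simp add: assoc commute[of b a] brk_antisym[of y] brk_antisym[of "y \<odot> a"])
  have t: "scale 2 ?t = - \<lbrace>x \<odot> a, y \<odot> b\<rbrace> - \<lbrace>x \<odot> (a \<odot> b), y\<rbrace>"
    by (simp only: transposed_leibniz)
      (simp add: assoc brk_antisym[of y] brk_antisym[of "y \<odot> b"])
  have u: "scale 2 ?u = \<lbrace>x \<odot> a, y \<odot> b\<rbrace> + \<lbrace>x, y \<odot> (a \<odot> b)\<rbrace>"
    by (simp only: transposed_leibniz assoc commute[of b a])
  have v: "scale 2 ?v = - ?unsplit"
    by (simp only: assoc transposed_leibniz)
      (simp add: brk_antisym[of y] brk_antisym[of "y \<odot> (a \<odot> b)"])
  have "scale 2 (?p - ?q + ?r - ?s - ?t + ?u + scale 2 ?v)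
      = (?p + ?p) - (?q + ?q) + scale 2 ?r - scale 2 ?s - scale 2 ?t + scale 2 ?u
        + (scale 2 ?v + scale 2 ?v)"
    by (simp only: scale_right_distrib scale_right_diff_distrib scale_two[of ?p] scale_two[of ?q]
        scale_two[of "scale 2 ?v"])
  also have "\<dots> = 0"
    unfolding p r s t u v by (simp add: algebra_simps)
  finally show "scale 2 (?p - ?q + ?r - ?s - ?t + ?u + scale 2 ?v) = 0" .
qed

end

theorem theorem4p1:
  fixes scale :: "'k::field_char_0 \<Rightarrow> 'a::ab_group_add \<Rightarrow> 'a"
    and circ :: "'a \<Rightarrow> 'a \<Rightarrow> 'a"  (infixl \<open>\<odot>\<close> 70)
    and brk :: "'a \<Rightarrow> 'a \<Rightarrow> 'a"  (\<open>\<lbrace>_, _\<rbrace>\<close>)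
  assumes "transposed_poisson_algebra scale circ brk"
  shows "\<forall>x1 x2 x3 x4.
      \<lbrace>x1, (x2 \<odot> x3) \<odot> x4\<rbrace> - \<lbrace>x1, x2 \<odot> x3\<rbrace> \<odot> x4 - \<lbrace>x1, x2 \<odot> x4\<rbrace> \<odot> x3
        + (\<lbrace>x1, x2\<rbrace> \<odot> x3) \<odot> x4 = 0
    \<and> \<lbrace>x4 \<odot> x1, x3 \<odot> x2\<rbrace> - \<lbrace>x3 \<odot> x1, x4 \<odot> x2\<rbrace>
        + \<lbrace>x3, x4 \<odot> x1\<rbrace> \<odot> x2 - \<lbrace>x4, x3 \<odot> x2\<rbrace> \<odot> x1
        - \<lbrace>x4, x3 \<odot> x1\<rbrace> \<odot> x2 + \<lbrace>x3, x4 \<odot> x2\<rbrace> \<odot> x1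
        + scale 2 ((\<lbrace>x4, x3\<rbrace> \<odot> x1) \<odot> x2) = 0"
proof -
  interpret transposed_poisson_algebra scale circ brk
    by (rule assms)
  show ?thesis
    by (intro allI conjI brk_differential_operator brk_exchange)
qed

end
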